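(* Let $(E,p,V)$ and $(F,q,W)$ be lattice-normed spaces and let $T:E\to F$ be a linear operator. If $T$ is $p$-compact, then $T$ is $p$-bounded.
   Context: All vector spaces are real and the vector lattices in which vector norms take values are Archimedean. A lattice-normed space $(E,p,V)$ consists of a vector space $E$, an Archimedean vector lattice $V$, and a map $p:E\to V$ (a vector norm) such that for all $x,x_1,x_2\in E$ and $\lambda\in\mathbb{R}$: $p(x)\ge 0$; $p(x)=0$ if and only if $x=0$; $p(x_1+x_2)\le p(x_1)+p(x_2)$; $p(\lambda x)=|\lambda|\,p(x)$. A subset $M\subset E$ is $p$-bounded if there is $e\in V_+$ with $p(M)\subset[-e,e]$ (i.e. $p(x)\le e$ for all $x\in M$). A net is $p$-bounded if its set of terms is $p$-bounded. A net $(x_\alpha)_{\alpha\in\Delta}$ in $E$ $p$-converges to $x\in E$ if there is a decreasing net $(e_\gamma)_{\gamma\in\Gamma}$ in $V$ (over a possibly different directed index set $\Gamma$) with $\inf_{\gamma}e_\gamma=0$ such that for every $\gamma\in\Gamma$ there is $\alpha(\gamma)\in\Delta$ with $p(x-x_\alpha)\le e_\gamma$ for all $\alpha\ge\alpha(\gamma)$. A subnet of a net $(x_\alpha)_{\alpha\in\Delta}$ is a net $(x_{\varphi(\beta)})_{\beta\in B}$, where $B$ is a directed set and $\varphi:B\to\Delta$ is such that for every $\alpha_0\in\Delta$ there is $\beta_0\in B$ with $\varphi(\beta)\ge\alpha_0$ for all $\beta\ge\beta_0$. The same notions are used in $(F,q,W)$ with respect to $q$. The linear operator $T$ is $p$-compact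 if for every $p$-bounded net $(x_\alpha)$ in $E$ there are a subnet $(x_{\varphi(\beta)})_{\beta\in B}$ and an element $y\in F$ such that $(Tx_{\varphi(\beta)})_{\beta\in B}$ $q$-converges to $y$ in $(F,q,W)$, i.e. there is a decreasing net $(w_\gamma)_{\gamma\in\Gamma}$ in $W$ with $\inf_\gamma w_\gamma=0$ such that for every $\gamma\in\Gamma$ there is $\beta(\gamma)\in B$ with $q(y-Tx_{\varphi(\beta)})\le w_\gamma$ for all $\beta\ge\beta(\gamma)$. The operator $T$ is $p$-bounded if it maps every $p$-bounded subset of $E$ to a $q$-bounded subset of $F$. *)

theory Defs
  imports Complex_Main "HOL-Library.Lub_Glb"
begin

section \<open>Lattice-normed spaces\<close>

text \<open>
  The class axiom says that \<open>inf\<^sub>n (1 / (n + 1)) u = 0\<close> for \<open>u \<ge> 0\<close>; that \<open>0\<close> is a lower bound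
  is automatic.
\<close>

class archimedean_vector_lattice = ordered_real_vector + lattice +
  assumes archimedean: "\<lbrakk>0 \<le> u; \<forall>n. v \<le> (1 / real (Suc n)) *\<^sub>R u\<rbrakk> \<Longrightarrow> v \<le> 0"

instance real :: archimedean_vector_lattice
proof
  fix u v :: real
  assume v: "\<forall>n. v \<le> (1 / real (Suc n)) *\<^sub>R u"
  show "v \<le> 0"
  proof (rule LIMSEQ_le_const)
    show "(\<lambda>n. (1 / real (Suc n)) *\<^sub>R u) \<longlonglongrightarrow> 0"
      using tendsto_mult_left_zero[OF LIMSEQ_inverse_real_of_nat, of u]
      by (simp add: inverse_eq_divide)
    show "\<exists>N. \<forall>n\<ge>N. v \<le> (1 / real (Suc n)) *\<^sub>R u"
      using v by blast
  qed
qed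

locale lattice_normed_space =
  fixes p :: "'e::real_vector \<Rightarrow> 'v::archimedean_vector_lattice"
  assumes nonneg: "0 \<le> p x"
    and eq_0_iff: "p x = 0 \<longleftrightarrow> x = 0"
    and triangle: "p (x + y) \<le> p x + p y"
    and scale: "p (a *\<^sub>R x) = \<bar>a\<bar> *\<^sub>R p x"

definition p_bounded_set :: "('e \<Rightarrow> 'v::archimedean_vector_lattice) \<Rightarrow> 'e set \<Rightarrow> bool"
  where "p_bounded_set p M \<longleftrightarrow> (\<exists>e\<ge>0. p ` M \<subseteq> {- e..e})"

definition p_bounded_operator ::
  "('e \<Rightarrow> 'v::archimedean_vector_lattice) \<Rightarrow> ('f \<Rightarrow> 'w::archimedean_vector_lattice)
    \<Rightarrow> ('e \<Rightarrow> 'f) \<Rightarrow> bool"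
  where "p_bounded_operator p q T \<longleftrightarrow>
    (\<forall>M. p_bounded_set p M \<longrightarrow> p_bounded_set q (T ` M))"


section \<open>Nets\<close>

text \<open>
  A net is a function \<^term>\<open>x\<close> together with an index set \<^term>\<open>A\<close> and a relation
  \<^term>\<open>le\<close> directing it; \<^term>\<open>x\<close> and \<^term>\<open>le\<close> matter on \<^term>\<open>A\<close> only.
  A direction is a preorder, not necessarily antisymmetric.
\<close>

definition directed_set :: "'i set \<Rightarrow> ('i \<Rightarrow> 'i \<Rightarrow> bool) \<Rightarrow> bool"
  where "directed_set A le \<longleftrightarrow> A \<noteq> {} \<and> reflp_on A le \<and> transp_on A le \<and>
    (\<forall>a\<in>A. \<forall>b\<in>A. \<exists>c\<in>A. le a c \<and> le b c)"

definition subnet_map ::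
  "'i set \<Rightarrow> ('i \<Rightarrow> 'i \<Rightarrow> bool) \<Rightarrow> 'b set \<Rightarrow> ('b \<Rightarrow> 'b \<Rightarrow> bool) \<Rightarrow> ('b \<Rightarrow> 'i) \<Rightarrow> bool"
  where "subnet_map A le B leB \<phi> \<longleftrightarrow> directed_set B leB \<and> \<phi> ` B \<subseteq> A \<and>
    (\<forall>a\<in>A. \<exists>b\<in>B. \<forall>b'\<in>B. leB b b' \<longrightarrow> le a (\<phi> b'))"

definition decreasing_to_0 ::
  "'g set \<Rightarrow> ('g \<Rightarrow> 'g \<Rightarrow> bool) \<Rightarrow> ('g \<Rightarrow> 'v::archimedean_vector_lattice) \<Rightarrow> bool"
  where "decreasing_to_0 G leG e \<longleftrightarrow> directed_set G leG \<and>
    monotone_on G leG (\<lambda>u v. v \<le> u) e \<and> isGlb UNIV (e ` G) 0"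

text \<open>
  A definition cannot quantify over all index types, so index types are fixed here:
  \<^typ>\<open>'v\<close> for the dominating decreasing net, \<^typ>\<open>'e \<times> 'e set\<close> for the nets tested in the
  definition of a \<open>p\<close>-compact operator, and \<^typ>\<open>'i \<times> 'i set\<close> for the subnets of a net indexed
  by \<^typ>\<open>'i\<close>. This is no restriction: the lemmas \<open>p_convergesI\<close>,
  \<open>p_convergent_subnet_reindex\<close> and \<open>p_compact_operator_net\<close> below show that nets, subnets
  and decreasing nets over arbitrary index types give the same notions.
\<close>

definition p_converges ::
  "('e::real_vector \<Rightarrow> 'v::archimedean_vector_lattice) \<Rightarrow> 'i set \<Rightarrow> ('i \<Rightarrow> 'i \<Rightarrow> bool)
    \<Rightarrow> ('i \<Rightarrow> 'e) \<Rightarrow> 'e \<Rightarrow> bool"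
  where "p_converges p A le x l \<longleftrightarrow>
    (\<exists>(G :: 'v set) leG e. decreasing_to_0 G leG e \<and>
      (\<forall>g\<in>G. \<exists>a\<in>A. \<forall>a'\<in>A. le a a' \<longrightarrow> p (l - x a') \<le> e g))"

definition p_compact_operator ::
  "('e::real_vector \<Rightarrow> 'v::archimedean_vector_lattice)
    \<Rightarrow> ('f::real_vector \<Rightarrow> 'w::archimedean_vector_lattice) \<Rightarrow> ('e \<Rightarrow> 'f) \<Rightarrow> bool"
  where "p_compact_operator p q T \<longleftrightarrow>
    (\<forall>(A :: ('e \<times> 'e set) set) le x.
      directed_set A le \<and> p_bounded_set p (x ` A) \<longrightarrow>
      (\<exists>(B :: (('e \<times> 'e set) \<times> ('e \<times> 'e set) set) set) leB \<phi> y.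
        subnet_map A le B leB \<phi> \<and> p_converges q B leB (\<lambda>b. T (x (\<phi> b))) y))"


section \<open>Independence of the index types\<close>

lemma directed_setD:
  assumes "directed_set A le"
  shows "\<exists>a. a \<in> A"
    and "a \<in> A \<Longrightarrow> le a a"
    and "\<lbrakk>le a b; le b c; a \<in> A; b \<in> A; c \<in> A\<rbrakk> \<Longrightarrow> le a c"
    and "\<lbrakk>a \<in> A; b \<in> A\<rbrakk> \<Longrightarrow> \<exists>c\<in>A. le a c \<and> le b c"
  using assms unfolding directed_set_def
  by (auto dest: reflp_onD transp_onD)

lemma p_convergesI:
  fixes G :: "'g set" and e :: "'g \<Rightarrow> 'v::archimedean_vector_lattice"
  assumes G: "decreasing_to_0 G leG e"
    and conv: "\<forall>g\<in>G. \<exists>a\<in>A. \<forall>a'\<in>A. le a a' \<longrightarrow> p (l - x a') \<le> e g"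
  shows "p_converges p A le x l"
proof -
  have dir: "directed_set G leG" and mono: "monotone_on G leG (\<lambda>u v. v \<le> u) e"
    and inf: "isGlb UNIV (e ` G) 0"
    using G by (auto simp: decreasing_to_0_def)
  have "directed_set (e ` G) (\<lambda>u v. v \<le> u)"
    unfolding directed_set_def
  proof (intro conjI)
    show "e ` G \<noteq> {}"
      using directed_setD(1)[OF dir] by auto
    show "reflp_on (e ` G) (\<lambda>u v. v \<le> u)"
      by (auto intro: reflp_onI)
    show "transp_on (e ` G) (\<lambda>u v. v \<le> u)"
      by (auto intro: transp_onI order_trans)
    show "\<forall>a\<in>e ` G. \<forall>b\<in>e ` G. \<exists>c\<in>e ` G. c \<le> a \<and> c \<le> b"
    proof (clarify)
      fix a b
      assume ab: "a \<in> G" "b \<in> G"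
      obtain c where c: "c \<in> G" "leG a c" "leG b c"
        using directed_setD(4)[OF dir ab] by blast
      have "e c \<le> e a" "e c \<le> e b"
        using monotone_onD[OF mono] ab c by auto
      with c show "\<exists>c\<in>e ` G. c \<le> e a \<and> c \<le> e b"
        by blast
    qed
  qed
  then have "decreasing_to_0 (e ` G) (\<lambda>u v. v \<le> u) (\<lambda>v. v)"
    using inf by (simp add: decreasing_to_0_def monotone_on_def)
  moreover have "\<forall>g\<in>e ` G. \<exists>a\<in>A. \<forall>a'\<in>A. le a a' \<longrightarrow> p (l - x a') \<le> g"
    using conv by blast
  ultimately show ?thesis
    unfolding p_converges_def by blast
qed

lemma p_convergent_subnet_reindex:
  fixes A :: "'i set" and B :: "'b set"
    and q :: "'f::real_vector \<Rightarrow> 'w::archimedean_vector_lattice"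
  assumes A: "directed_set A le"
    and sub: "subnet_map A le B leB \<phi>"
    and conv: "p_converges q B leB (\<lambda>b. z (\<phi> b)) y"
  shows "\<exists>(C :: ('i \<times> 'i set) set) leC \<psi>.
    subnet_map A le C leC \<psi> \<and> p_converges q C leC (\<lambda>c. z (\<psi> c)) y"
proof -
  define S where "S b = \<phi> ` {b' \<in> B. leB b b'}" for b
  define C where "C = {(a, S b) | a b. b \<in> B \<and> a \<in> S b}"
  define leC :: "'i \<times> 'i set \<Rightarrow> 'i \<times> 'i set \<Rightarrow> bool"
    where "leC c d \<longleftrightarrow> snd d \<subseteq> snd c" for c d
  have B: "directed_set B leB" and \<phi>: "\<phi> ` B \<subseteq> A"
    and cof: "\<And>a. a \<in> A \<Longrightarrow> \<exists>b\<in>B. \<forall>b'\<in>B. leB b b' \<longrightarrow> le a (\<phi> b')"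
    using sub by (auto simp: subnet_map_def)
  have C_base: "(\<phi> b, S b) \<in> C" if "b \<in> B" for b
    using that directed_setD(2)[OF B] by (auto simp: C_def S_def)
  have tail: "\<exists>c\<in>C. \<forall>d\<in>C. leC c d \<longrightarrow> P (fst d)"
    if b: "b \<in> B" and P: "\<And>b'. b' \<in> B \<Longrightarrow> leB b b' \<Longrightarrow> P (\<phi> b')" for b P
  proof (intro bexI[OF _ C_base[OF b]] ballI impI)
    fix d
    assume "d \<in> C" "leC (\<phi> b, S b) d"
    then have "fst d \<in> S b"
      by (auto simp: C_def leC_def)
    then show "P (fst d)"
      using P by (auto simp: S_def)
  qed
  have "directed_set C leC"
    unfolding directed_set_def
  proof (intro conjI ballI)
    show "C \<noteq> {}"
      using directed_setD(1)[OF B] C_base by blast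
    show "reflp_on C leC" "transp_on C leC"
      by (auto intro!: reflp_onI transp_onI simp: leC_def)
    fix c d
    assume "c \<in> C" "d \<in> C"
    then obtain b1 b2 where b: "b1 \<in> B" "b2 \<in> B" "snd c = S b1" "snd d = S b2"
      by (auto simp: C_def)
    obtain b where b': "b \<in> B" "leB b1 b" "leB b2 b"
      using directed_setD(4)[OF B b(1,2)] by blast
    then have "S b \<subseteq> S b1" "S b \<subseteq> S b2"
      using directed_setD(3)[OF B] b unfolding S_def by blast+
    then show "\<exists>k\<in>C. leC c k \<and> leC d k"
      using C_base[OF b'(1)] b by (intro bexI[of _ "(\<phi> b, S b)"]) (auto simp: leC_def)
  qed
  moreover have "fst ` C \<subseteq> A"
    using \<phi> by (auto simp: C_def S_def)
  moreover have "\<forall>a\<in>A. \<exists>c\<in>C. \<forall>d\<in>C. leC c d \<longrightarrow> le a (fst d)"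
  proof
    fix a
    assume "a \<in> A"
    then obtain b where "b \<in> B" "\<forall>b'\<in>B. leB b b' \<longrightarrow> le a (\<phi> b')"
      using cof by blast
    then show "\<exists>c\<in>C. \<forall>d\<in>C. leC c d \<longrightarrow> le a (fst d)"
      by (intro tail[where P = "le a"]) auto
  qed
  ultimately have "subnet_map A le C leC fst"
    by (simp add: subnet_map_def)
  moreover have "p_converges q C leC (\<lambda>c. z (fst c)) y"
  proof -
    obtain G :: "'w set" and leG e where G: "decreasing_to_0 G leG e"
      and e: "\<And>g. g \<in> G \<Longrightarrow> \<exists>b\<in>B. \<forall>b'\<in>B. leB b b' \<longrightarrow> q (y - z (\<phi> b')) \<le> e g"
      using conv unfolding p_converges_def by blast
    have "\<forall>g\<in>G. \<exists>c\<in>C. \<forall>d\<in>C. leC c d \<longrightarrow> q (y - z (fst d)) \<le> e g"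
    proof
      fix g
      assume "g \<in> G"
      then obtain b where "b \<in> B" "\<forall>b'\<in>B. leB b b' \<longrightarrow> q (y - z (\<phi> b')) \<le> e g"
        using e by blast
      then show "\<exists>c\<in>C. \<forall>d\<in>C. leC c d \<longrightarrow> q (y - z (fst d)) \<le> e g"
        by (intro tail[where P = "\<lambda>a. q (y - z a) \<le> e g"]) auto
    qed
    with G show ?thesis
      by (rule p_convergesI)
  qed
  ultimately show ?thesis
    by blast
qed

lemma p_compact_operator_net:
  fixes A :: "'i set" and x :: "'i \<Rightarrow> 'e::real_vector"
    and q :: "'f::real_vector \<Rightarrow> 'w::archimedean_vector_lattice"
  assumes T: "p_compact_operator p q T"
    and A: "directed_set A le"
    and bdd: "p_bounded_set p (x ` A)"
  shows "\<exists>(B :: ('i \<times> 'i set) set) leB \<phi> y.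
    subnet_map A le B leB \<phi> \<and> p_converges q B leB (\<lambda>b. T (x (\<phi> b))) y"
proof -
  define S where "S a = x ` {a' \<in> A. le a a'}" for a
  define C where "C = {(v, S a) | v a. a \<in> A \<and> v \<in> S a}"
  define leC :: "'e \<times> 'e set \<Rightarrow> 'e \<times> 'e set \<Rightarrow> bool"
    where "leC c d \<longleftrightarrow> snd d \<subseteq> snd c" for c d
  have C_base: "(x a, S a) \<in> C" if "a \<in> A" for a
    using that directed_setD(2)[OF A] by (auto simp: C_def S_def)
  have "directed_set C leC"
    unfolding directed_set_def
  proof (intro conjI ballI)
    show "C \<noteq> {}"
      using directed_setD(1)[OF A] C_base by blast
    show "reflp_on C leC" "transp_on C leC"
      by (auto intro!: reflp_onI transp_onI simp: leC_def)
    fix c d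
    assume "c \<in> C" "d \<in> C"
    then obtain a1 a2 where a: "a1 \<in> A" "a2 \<in> A" "snd c = S a1" "snd d = S a2"
      by (auto simp: C_def)
    obtain a where a': "a \<in> A" "le a1 a" "le a2 a"
      using directed_setD(4)[OF A a(1,2)] by blast
    then have "S a \<subseteq> S a1" "S a \<subseteq> S a2"
      using directed_setD(3)[OF A] a unfolding S_def by blast+
    then show "\<exists>k\<in>C. leC c k \<and> leC d k"
      using C_base[OF a'(1)] a by (intro bexI[of _ "(x a, S a)"]) (auto simp: leC_def)
  qed
  moreover have "fst ` C \<subseteq> x ` A"
    by (auto simp: C_def S_def)
  then have "p_bounded_set p (fst ` C)"
    using bdd unfolding p_bounded_set_def by (meson image_mono subset_trans)
  ultimately obtain B :: "(('e \<times> 'e set) \<times> ('e \<times> 'e set) set) set" and leB \<phi> y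
    where sub: "subnet_map C leC B leB \<phi>"
      and conv: "p_converges q B leB (\<lambda>b. T (fst (\<phi> b))) y"
    using T[unfolded p_compact_operator_def, rule_format, of C leC fst] by blast
  have B: "directed_set B leB" and \<phi>: "\<And>b. b \<in> B \<Longrightarrow> \<phi> b \<in> C"
    and cof: "\<And>c. c \<in> C \<Longrightarrow> \<exists>b\<in>B. \<forall>b'\<in>B. leB b b' \<longrightarrow> leC c (\<phi> b')"
    using sub by (auto simp: subnet_map_def)
  define D where "D = {(a, b). a \<in> A \<and> b \<in> B \<and> x a = fst (\<phi> b)}"
  define leD where "leD c d \<longleftrightarrow> le (fst c) (fst d) \<and> leB (snd c) (snd d)" for c d
  have above: "\<exists>d\<in>D. le a (fst d) \<and> leB b (snd d)" if "a \<in> A" "b \<in> B" for a b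
  proof -
    obtain b0 where b0: "b0 \<in> B" "\<And>b'. b' \<in> B \<Longrightarrow> leB b0 b' \<Longrightarrow> leC (x a, S a) (\<phi> b')"
      using cof[OF C_base[OF \<open>a \<in> A\<close>]] by blast
    obtain b' where b': "b' \<in> B" "leB b b'" "leB b0 b'"
      using directed_setD(4)[OF B \<open>b \<in> B\<close> b0(1)] by blast
    have "leC (x a, S a) (\<phi> b')" "\<phi> b' \<in> C"
      using b0 b' \<phi> by auto
    then have "fst (\<phi> b') \<in> S a"
      by (auto simp: C_def leC_def)
    then obtain a' where "a' \<in> A" "le a a'" "x a' = fst (\<phi> b')"
      by (auto simp: S_def)
    then show ?thesis
      using b' by (intro bexI[of _ "(a', b')"]) (auto simp: D_def)
  qed
  have "directed_set D leD"
    unfolding directed_set_def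
  proof (intro conjI ballI)
    show "D \<noteq> {}"
      using directed_setD(1)[OF A] directed_setD(1)[OF B] above by blast
    show "reflp_on D leD"
      using directed_setD(2)[OF A] directed_setD(2)[OF B]
      by (auto intro!: reflp_onI simp: D_def leD_def)
    show "transp_on D leD"
    proof (rule transp_onI)
      fix c d k
      assume "c \<in> D" "d \<in> D" "k \<in> D" "leD c d" "leD d k"
      then show "leD c k"
        using directed_setD(3)[OF A, of "fst c" "fst d" "fst k"]
          directed_setD(3)[OF B, of "snd c" "snd d" "snd k"]
        by (auto simp: D_def leD_def)
    qed
    fix c d
    assume "c \<in> D" "d \<in> D"
    then have m: "fst c \<in> A" "fst d \<in> A" "snd c \<in> B" "snd d \<in> B"
      by (auto simp: D_def)
    obtain a where a: "a \<in> A" "le (fst c) a" "le (fst d) a"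
      using directed_setD(4)[OF A m(1,2)] by blast
    obtain b where b: "b \<in> B" "leB (snd c) b" "leB (snd d) b"
      using directed_setD(4)[OF B m(3,4)] by blast
    obtain k where k: "k \<in> D" "le a (fst k)" "leB b (snd k)"
      using above[OF a(1) b(1)] by blast
    then have kk: "fst k \<in> A" "snd k \<in> B"
      by (auto simp: D_def)
    have "leD c k \<and> leD d k"
      unfolding leD_def
      using directed_setD(3)[OF A a(2) k(2)] directed_setD(3)[OF A a(3) k(2)]
        directed_setD(3)[OF B b(2) k(3)] directed_setD(3)[OF B b(3) k(3)] a b m kk
      by blast
    with k(1) show "\<exists>k\<in>D. leD c k \<and> leD d k"
      by blast
  qed
  moreover have "fst ` D \<subseteq> A"
    by (auto simp: D_def)
  moreover have "\<forall>a\<in>A. \<exists>c\<in>D. \<forall>d\<in>D. leD c d \<longrightarrow> le a (fst d)"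
  proof
    fix a
    assume a: "a \<in> A"
    obtain b where "b \<in> B"
      using directed_setD(1)[OF B] by blast
    then obtain c where c: "c \<in> D" "le a (fst c)"
      using above[OF a] by blast
    have "le a (fst d)" if "d \<in> D" "leD c d" for d
      using directed_setD(3)[OF A c(2), of "fst d"] a c(1) that by (auto simp: D_def leD_def)
    with c(1) show "\<exists>c\<in>D. \<forall>d\<in>D. leD c d \<longrightarrow> le a (fst d)"
      by blast
  qed
  ultimately have subD: "subnet_map A le D leD fst"
    by (simp add: subnet_map_def)
  have "p_converges q D leD (\<lambda>d. T (x (fst d))) y"
  proof -
    obtain G :: "'w set" and leG e where G: "decreasing_to_0 G leG e"
      and e: "\<And>g. g \<in> G \<Longrightarrow> \<exists>b\<in>B. \<forall>b'\<in>B. leB b b' \<longrightarrow> q (y - T (fst (\<phi> b'))) \<le> e g"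
      using conv unfolding p_converges_def by blast
    have "\<forall>g\<in>G. \<exists>c\<in>D. \<forall>d\<in>D. leD c d \<longrightarrow> q (y - T (x (fst d))) \<le> e g"
    proof
      fix g
      assume "g \<in> G"
      then obtain b where b: "b \<in> B" "\<And>b'. b' \<in> B \<Longrightarrow> leB b b' \<Longrightarrow> q (y - T (fst (\<phi> b'))) \<le> e g"
        using e by blast
      obtain a where "a \<in> A"
        using directed_setD(1)[OF A] by blast
      then obtain c where c: "c \<in> D" "leB b (snd c)"
        using above b(1) by blast
      have "q (y - T (x (fst d))) \<le> e g" if d: "d \<in> D" "leD c d" for d
      proof -
        have "snd d \<in> B" "snd c \<in> B" "x (fst d) = fst (\<phi> (snd d))"
          using c d by (auto simp: D_def)
        moreover from this have "leB b (snd d)"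
          using directed_setD(3)[OF B c(2), of "snd d"] b(1) d(2) by (auto simp: leD_def)
        ultimately show ?thesis
          using b(2) by simp
      qed
      with c(1) show "\<exists>c\<in>D. \<forall>d\<in>D. leD c d \<longrightarrow> q (y - T (x (fst d))) \<le> e g"
        by blast
    qed
    with G show ?thesis
      by (rule p_convergesI)
  qed
  then have "\<exists>(C :: ('i \<times> 'i set) set) leC \<psi>.
    subnet_map A le C leC \<psi> \<and> p_converges q C leC (\<lambda>c. T (x (\<psi> c))) y"
    by (rule p_convergent_subnet_reindex[where z = "\<lambda>i. T (x i)", OF A subD])
  then show ?thesis
    by blast
qed

end

theory Submission
  imports Defs
begin

text \<open>
  If \<open>q (T ` M)\<close> has no upper bound, choose for each \<open>w\<close> in \<open>W\<close> some \<open>x\<^sub>w \<in> M\<close> with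
  \<open>q (T x\<^sub>w) \<le> w\<close> false. For the net indexed by the lattice \<open>W\<close> itself, \<open>q (T x\<^sub>v) \<le> w\<close> then
  fails for all \<open>v \<ge> w\<close>, so no subnet of the image net has a bounded tail, and convergent nets do.
\<close>

text \<open>The lower half of the order interval is automatic from \<open>nonneg\<close>. The bound
  \<open>sup w 0\<close> can differ from \<open>w\<close> only when \<open>M\<close> is empty, where
  nothing forces \<open>w\<close> to be nonnegative.\<close>

lemma (in lattice_normed_space) p_bounded_setI:
  assumes "\<And>x. x \<in> M \<Longrightarrow> p x \<le> w"
  shows "p_bounded_set p M"
proof -
  have "p x \<in> {- sup w 0..sup w 0}" if "x \<in> M" for x
  proof -
    have "- sup w 0 \<le> 0"
      by simp
    also have "0 \<le> p x"
      by (rule nonneg)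
    finally show ?thesis
      using assms[OF that] by (simp add: le_supI1)
  qed
  then show ?thesis
    unfolding p_bounded_set_def by (intro exI[of _ "sup w 0"]) auto
qed

text \<open>A single term \<open>e g\<close> of the dominating net suffices: on its tail the
  triangle inequality gives the bound \<open>p l + e g\<close>.\<close>

lemma (in lattice_normed_space) p_converges_eventually_bounded:
  assumes "p_converges p A le x l"
  shows "\<exists>w. \<exists>a\<in>A. \<forall>a'\<in>A. le a a' \<longrightarrow> p (x a') \<le> w"
proof -
  obtain G :: "'v set" and leG e where G: "decreasing_to_0 G leG e"
    and e: "\<And>g. g \<in> G \<Longrightarrow> \<exists>a\<in>A. \<forall>a'\<in>A. le a a' \<longrightarrow> p (l - x a') \<le> e g"
    using assms unfolding p_converges_def by blast
  obtain g where "g \<in> G"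
    using G directed_setD(1) unfolding decreasing_to_0_def by blast
  then obtain a where a: "a \<in> A" "\<And>a'. a' \<in> A \<Longrightarrow> le a a' \<Longrightarrow> p (l - x a') \<le> e g"
    using e by blast
  have "p (x a') \<le> p l + e g" if "a' \<in> A" "le a a'" for a'
  proof -
    \<comment> \<open>The difference is put as a sum with a scalar multiple, the form that
      \<open>triangle\<close> and \<open>scale\<close> expect.\<close>
    have "p (x a') = p (l + (-1) *\<^sub>R (l - x a'))"
      by simp
    also have "\<dots> \<le> p l + p ((-1) *\<^sub>R (l - x a'))"
      by (rule triangle)
    also have "\<dots> = p l + p (l - x a')"
      by (simp only: scale) simp
    also have "\<dots> \<le> p l + e g"
      using a(2)[OF that] by simp
    finally show ?thesis .
  qed
  with a(1) show ?thesis
    by blast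
qed

theorem theorem2:
  fixes p :: "'e::real_vector \<Rightarrow> 'v::archimedean_vector_lattice"
    and q :: "'f::real_vector \<Rightarrow> 'w::archimedean_vector_lattice"
    and T :: "'e \<Rightarrow> 'f"
  assumes "lattice_normed_space p"
    and "lattice_normed_space q"
    and "linear T"
    and "p_compact_operator p q T"
  shows "p_bounded_operator p q T"
  unfolding p_bounded_operator_def
proof (intro allI impI, rule ccontr)
  interpret q: lattice_normed_space q
    by fact
  fix M
  assume M: "p_bounded_set p M" and unbdd: "\<not> p_bounded_set q (T ` M)"
  have "\<exists>x\<in>M. \<not> q (T x) \<le> w" for w
    using q.p_bounded_setI[of "T ` M" w] unbdd by blast
  then obtain x where x: "\<And>w. x w \<in> M" "\<And>w. \<not> q (T (x w)) \<le> w"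
    by metis
  have "directed_set (UNIV :: 'w set) (\<le>)"
    unfolding directed_set_def
  proof (intro conjI ballI)
    show "reflp_on UNIV ((\<le>) :: 'w \<Rightarrow> _)" "transp_on UNIV ((\<le>) :: 'w \<Rightarrow> _)"
      by simp_all
    show "\<exists>c\<in>UNIV. a \<le> c \<and> b \<le> c" for a b :: 'w
      by (intro bexI[of _ "sup a b"]) simp_all
  qed simp
  moreover have "p_bounded_set p (range x)"
    using M x(1) unfolding p_bounded_set_def by (meson image_mono image_subsetI order_trans)
  \<comment> \<open>The net is indexed by \<open>'w\<close>, whereas
    \<open>p_compact_operator\<close> tests index type \<open>'e \<times> 'e set\<close>;
    \<open>p_compact_operator_net\<close> bridges the two.\<close>
  ultimately obtain B :: "('w \<times> 'w set) set" and leB \<phi> y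
    where sub: "subnet_map UNIV (\<le>) B leB \<phi>"
      and conv: "p_converges q B leB (\<lambda>b. T (x (\<phi> b))) y"
    using p_compact_operator_net[OF assms(4)] by blast
  have B: "directed_set B leB"
    using sub by (simp add: subnet_map_def)
  obtain w b where b: "b \<in> B" "\<And>b'. b' \<in> B \<Longrightarrow> leB b b' \<Longrightarrow> q (T (x (\<phi> b'))) \<le> w"
    using q.p_converges_eventually_bounded[OF conv] by blast
  \<comment> \<open>The bound \<open>w\<close> of the tail is itself an index of the net, so
    cofinality of \<open>\<phi>\<close> applies to it.\<close>
  have "\<exists>c\<in>B. \<forall>b'\<in>B. leB c b' \<longrightarrow> w \<le> \<phi> b'"
    using sub by (simp add: subnet_map_def)
  then obtain c where c: "c \<in> B" "\<And>b'. b' \<in> B \<Longrightarrow> leB c b' \<Longrightarrow> w \<le> \<phi> b'"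
    by blast
  \<comment> \<open>Past both \<open>b\<close> and \<open>c\<close>, the bound \<open>w\<close> lies
    below the index \<open>\<phi> d\<close>, against the choice of \<open>x\<close> at
    \<open>\<phi> d\<close>.\<close>
  obtain d where "d \<in> B" "leB b d" "leB c d"
    using directed_setD(4)[OF B b(1) c(1)] by blast
  then have "q (T (x (\<phi> d))) \<le> w" "w \<le> \<phi> d"
    using b(2) c(2) by simp_all
  then have "q (T (x (\<phi> d))) \<le> \<phi> d"
    by (rule order_trans)
  with x(2) show False
    by blast
qed

end
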